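(* Let $\phi$ be an arbitrary scalar field with values $\phi_c$ in the cells $\omega_c$ of a two-dimensional Voronoi tessellation, and let $\mathbb{G}_p(\phi_c)=\nabla_h^c\phi_c$ be its discrete gradient on the dual triangles $\omega_p$, $$\nabla_h^c\phi_c=\frac{1}{|\omega_p|}\sum_{c\in\mathcal{C}(p)} l_{cp}\mathbf{n}_{cp}\,\phi_c .$$ For a vector field with values $\boldsymbol{\psi}_p$ on the dual triangles, let the discrete curl on the Voronoi cell $\omega_c$ be $$\nabla_h^p\times\boldsymbol{\psi}_p=-\frac{1}{|\omega_c|}\sum_{p\in\mathcal{P}(c)} l_{cp}\mathbf{t}_{cp}\cdot\boldsymbol{\psi}_p .$$ Then, on every Voronoi cell $\omega_c$ all of whose vertices are circumcenters of dual triangles, the discrete curl-grad identity holds: $$\nabla_h^p\times\left(\nabla_h^c\phi_c\right)_p=0 .$$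
   Context: Mesh. A two-dimensional domain $\Omega$ is partitioned into finitely many non-overlapping Voronoi cells $\omega_c$ with generators $\mathbf{x}_c$ and volumes (areas) $|\omega_c|$; the grid is conforming (every interior edge is shared by exactly two cells). Every vertex $\mathbf{x}_p$ of a Voronoi cell is the circumcenter of a triangle $\omega_p$, of area $|\omega_p|$, whose corners are the three generators of the surrounding Voronoi cells; these triangles form the dual Delaunay triangulation. $\mathcal{P}(c)$ is the set of vertices of the cell $\omega_c$; $\mathcal{C}(p)$ is the set of the three cells whose generators are the corners of $\omega_p$. Corner vectors. For $c\in\mathcal{C}(p)$ let $\mathbf{x}_{d^-},\mathbf{x}_{d^+}$ be the two other corners of $\omega_p$, let $\mathbf{n}^{\pm}$ be the unit normals, outward with respect to $\omega_p$, of the edges $\mathbf{x}_c\mathbf{x}_{d^\pm}$, and let $l^{\pm}=\tfrac12\|\mathbf{x}_c-\mathbf{x}_{d^\pm}\|$. Set $$l_{cp}\mathbf{n}_{cp}=l^-\mathbf{n}^-+l^+\mathbf{n}^+,\qquad l_{cp}\mathbf{t}_{cp}=\left(-l_{cp}\mathbf{n}_{cp}\cdot\mathbf{e}_y,\ l_{cp}\mathbf{n}_{cp}\cdot\mathbf{e}_x\right),$$ where $\mathbf{e}_x,\mathbf{e}_y$ is the standard basis of $\mathbb{R}^2$. *)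

theory Defs
  imports "HOL-Analysis.Analysis"
begin

text \<open>A mesh is given by a planar domain \<open>\<Omega>\<close>, a finite set \<open>C\<close> of cell labels and the generators
  \<open>x c\<close>. A vertex is identified with its position \<open>p\<close>, and the dual triangle belonging to it is
  determined by \<open>p\<close>; thus fields on the dual triangles are functions of \<open>p\<close>.\<close>

definition voronoi_mesh :: "(real^2) set \<Rightarrow> 'c set \<Rightarrow> ('c \<Rightarrow> real^2) \<Rightarrow> bool" where
  "voronoi_mesh \<Omega> C x \<longleftrightarrow>
     open \<Omega> \<and> connected \<Omega> \<and> bounded \<Omega> \<and> \<Omega> \<noteq> {} \<and> finite C \<and> inj_on x C"

text \<open>Cells are closed and cut off at the boundary of the domain. That they cover \<open>closure \<Omega>\<close>, do not
  overlap and meet in a conforming way follows from the definition.\<close>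

definition voronoi_cell :: "(real^2) set \<Rightarrow> 'c set \<Rightarrow> ('c \<Rightarrow> real^2) \<Rightarrow> 'c \<Rightarrow> (real^2) set" where
  "voronoi_cell \<Omega> C x c = {y \<in> closure \<Omega>. \<forall>d\<in>C. dist y (x c) \<le> dist y (x d)}"

text \<open>A reflex corner of a cell, which can occur only on the boundary of a non-convex \<open>\<Omega>\<close>, is not an
  extreme point. On a cell all of whose corners are dual vertices (see below) there are none.\<close>

definition cell_vertices :: "(real^2) set \<Rightarrow> 'c set \<Rightarrow> ('c \<Rightarrow> real^2) \<Rightarrow> 'c \<Rightarrow> (real^2) set" where
  "cell_vertices \<Omega> C x c = {p. p extreme_point_of voronoi_cell \<Omega> C x c}"

definition cells_at :: "(real^2) set \<Rightarrow> 'c set \<Rightarrow> ('c \<Rightarrow> real^2) \<Rightarrow> real^2 \<Rightarrow> 'c set" where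
  "cells_at \<Omega> C x p = {c \<in> C. p \<in> voronoi_cell \<Omega> C x c}"

definition dual_triangle :: "(real^2) set \<Rightarrow> 'c set \<Rightarrow> ('c \<Rightarrow> real^2) \<Rightarrow> real^2 \<Rightarrow> (real^2) set" where
  "dual_triangle \<Omega> C x p = convex hull (x ` cells_at \<Omega> C x p)"

text \<open>The vertex \<open>p\<close> is the circumcenter of a dual triangle whose corners are the generators of the
  three cells surrounding \<open>p\<close>. \<open>Surrounding\<close> means that these cells fill a neighbourhood of \<open>p\<close>;
  this excludes a point of the boundary of \<open>\<Omega>\<close> that happens to be equidistant from three
  generators, where the triangles need not close up around the cell.\<close>

definition dual_vertex :: "(real^2) set \<Rightarrow> 'c set \<Rightarrow> ('c \<Rightarrow> real^2) \<Rightarrow> real^2 \<Rightarrow> bool" where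
  "dual_vertex \<Omega> C x p \<longleftrightarrow>
     card (cells_at \<Omega> C x p) = 3 \<and>
     p \<in> interior (\<Union>c\<in>cells_at \<Omega> C x p. voronoi_cell \<Omega> C x c) \<and>
     \<not> collinear (x ` cells_at \<Omega> C x p) \<and>
     (\<exists>r. \<forall>c\<in>cells_at \<Omega> C x p. dist p (x c) = r)"

definition outward_normal :: "(real^2) set \<Rightarrow> real^2 \<Rightarrow> real^2 \<Rightarrow> real^2" where
  "outward_normal T a b =
     (THE n. norm n = 1 \<and> n \<bullet> (b - a) = 0 \<and> (\<forall>y\<in>T. n \<bullet> (y - a) \<le> 0))"

text \<open>The sum ranges over the two corners other than \<open>c\<close>, which makes it unnecessary to choose which
  of them is \<open>d\<^sup>-\<close> and which is \<open>d\<^sup>+\<close>.\<close>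

definition corner_normal ::
  "(real^2) set \<Rightarrow> 'c set \<Rightarrow> ('c \<Rightarrow> real^2) \<Rightarrow> 'c \<Rightarrow> real^2 \<Rightarrow> real^2" where
  "corner_normal \<Omega> C x c p =
     (\<Sum>d\<in>cells_at \<Omega> C x p - {c}.
        (1/2 * norm (x c - x d)) *\<^sub>R outward_normal (dual_triangle \<Omega> C x p) (x c) (x d))"

definition corner_tangent ::
  "(real^2) set \<Rightarrow> 'c set \<Rightarrow> ('c \<Rightarrow> real^2) \<Rightarrow> 'c \<Rightarrow> real^2 \<Rightarrow> real^2" where
  "corner_tangent \<Omega> C x c p =
     vector [- (corner_normal \<Omega> C x c p \<bullet> axis 2 1), corner_normal \<Omega> C x c p \<bullet> axis 1 1]"

definition discrete_grad ::
  "(real^2) set \<Rightarrow> 'c set \<Rightarrow> ('c \<Rightarrow> real^2) \<Rightarrow> ('c \<Rightarrow> real) \<Rightarrow> real^2 \<Rightarrow> real^2" where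
  "discrete_grad \<Omega> C x \<phi> p =
     (1 / measure lebesgue (dual_triangle \<Omega> C x p)) *\<^sub>R
       (\<Sum>c\<in>cells_at \<Omega> C x p. \<phi> c *\<^sub>R corner_normal \<Omega> C x c p)"

definition discrete_curl ::
  "(real^2) set \<Rightarrow> 'c set \<Rightarrow> ('c \<Rightarrow> real^2) \<Rightarrow> (real^2 \<Rightarrow> real^2) \<Rightarrow> 'c \<Rightarrow> real" where
  "discrete_curl \<Omega> C x \<psi> c =
     - (1 / measure lebesgue (voronoi_cell \<Omega> C x c)) *
       (\<Sum>p\<in>cell_vertices \<Omega> C x c. corner_tangent \<Omega> C x c p \<bullet> \<psi> p)"

end

theory Submission
  imports Defs
begin

text \<open>At a vertex \<open>p\<close> surrounded by the cells \<open>c, d, e\<close>, the outward normals of a triangle, weighted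
  by the edge lengths, are the edges turned by a right angle. Hence the corner tangent at \<open>c\<close> is
  half of \<open>\<plusminus> (x d - x e)\<close>, and its inner product with the gradient at \<open>p\<close> is
  \<open>\<plusminus> (\<phi> d - \<phi> e) / 2\<close>, the sign being the orientation of \<open>(x c, x d, x e)\<close>. Summing over the
  vertices and collecting the coefficient of \<open>\<phi> d\<close>, it remains to see that the edge shared by the
  cells of \<open>c\<close> and \<open>d\<close> has exactly two ends and that the orientations at them are opposite.\<close>

section \<open>Plane vectors: quarter turn and cross product\<close>

definition rot90 :: "real^2 \<Rightarrow> real^2" where
  "rot90 u = vector [- (u $ 2), u $ 1]"

text \<open>Twice the signed area of the triangle \<open>0\<close>, \<open>u\<close>,
  \<open>v\<close>; its sign is the orientation.\<close>

definition cross :: "real^2 \<Rightarrow> real^2 \<Rightarrow> real" where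
  "cross u v = u $ 1 * v $ 2 - u $ 2 * v $ 1"

lemma rot90_nth [simp]: "rot90 u $ 1 = - (u $ 2)" "rot90 u $ 2 = u $ 1"
  by (simp_all add: rot90_def)

lemma inner_real2: "(u::real^2) \<bullet> v = u $ 1 * v $ 1 + u $ 2 * v $ 2"
  by (simp add: inner_vec_def sum_2)

lemma real2_eq_iff: "(u::real^2) = v \<longleftrightarrow> u $ 1 = v $ 1 \<and> u $ 2 = v $ 2"
  by (simp add: vec_eq_iff forall_2)

lemma norm_rot90 [simp]: "norm (rot90 u) = norm u"
  by (simp add: norm_eq_sqrt_inner inner_real2)

lemma cross_eq_inner: "cross u v = rot90 u \<bullet> v"
  by (simp add: cross_def inner_real2)

lemma cross_self [simp]: "cross u u = 0" "cross u 0 = 0"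
  by (simp_all add: cross_def)

lemma rot90_orthogonal: "u \<bullet> rot90 u = 0"
  by (simp add: inner_real2)

text \<open>In the plane the orthogonal complement of \<open>u\<close> is the line spanned by
  \<open>rot90 u\<close>. The explicit coefficient later makes \<open>cross u\<close> a coordinate
  along a bisector.\<close>

lemma orthogonal_imp_multiple_rot90:
  fixes u n :: "real^2"
  assumes "n \<bullet> u = 0" "u \<noteq> 0"
  shows "n = (cross u n / (u \<bullet> u)) *\<^sub>R rot90 u"
proof -
  have nz: "u \<bullet> u \<noteq> 0" using assms by simp
  have "(u \<bullet> u) *\<^sub>R n = cross u n *\<^sub>R rot90 u"
    using assms(1) unfolding real2_eq_iff inner_real2 cross_def
    by (simp add: algebra_simps) algebra
  then have "(1 / (u \<bullet> u)) *\<^sub>R ((u \<bullet> u) *\<^sub>R n) = (1 / (u \<bullet> u)) *\<^sub>R (cross u n *\<^sub>R rot90 u)"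
    by simp
  then show ?thesis using nz by simp
qed

lemma cross_neq_0_if_not_collinear:
  fixes a b e :: "real^2"
  assumes "\<not> collinear {a, b, e}"
  shows "cross (b - a) (e - a) \<noteq> 0"
proof
  assume z: "cross (b - a) (e - a) = 0"
  have ba: "b \<noteq> a" using assms by (auto simp: insert_commute)
  have "rot90 (e - a) \<bullet> (b - a) = 0"
    using z by (simp add: cross_def inner_real2 algebra_simps)
  from orthogonal_imp_multiple_rot90[OF this] ba
  obtain k where "rot90 (e - a) = k *\<^sub>R rot90 (b - a)" by force
  then have "e - a = k *\<^sub>R (b - a)"
    by (simp add: real2_eq_iff) (simp add: algebra_simps)
  then have "collinear {0, b - a, e - a}"
    unfolding collinear_lemma by blast
  then have "collinear {b, a, e}"
    by (subst collinear_3) simp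
  then show False using assms by (simp add: insert_commute)
qed

section \<open>Outward normals and area of a triangle\<close>

text \<open>Orthogonality leaves two opposite unit multiples of \<open>rot90 (b - a)\<close>. The
  third corner \<open>e\<close> selects the outward one, so the sign is the orientation, and the
  weight cancels the normalisation.\<close>

lemma outward_normal_triangle:
  fixes a b e :: "real^2"
  assumes "cross (b - a) (e - a) \<noteq> 0"
  shows "norm (a - b) *\<^sub>R outward_normal (convex hull {a, b, e}) a b
           = - (sgn (cross (b - a) (e - a)) *\<^sub>R rot90 (b - a))"
proof -
  define u w D where "u = b - a" and "w = e - a" and "D = cross u w"
  have D0: "D \<noteq> 0" using assms by (simp add: u_def w_def D_def)
  then have u0: "u \<noteq> 0" by (auto simp: D_def cross_def)
  define n0 where "n0 = (- (sgn D / norm u)) *\<^sub>R rot90 u"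
  have "outward_normal (convex hull {a, b, e}) a b = n0"
    unfolding outward_normal_def
  proof (rule the_equality, intro conjI ballI)
    show "norm n0 = 1"
      using D0 u0 by (simp add: n0_def abs_sgn_eq)
    show "n0 \<bullet> (b - a) = 0"
      by (simp add: n0_def flip: u_def) (simp add: inner_real2)
    fix y assume "y \<in> convex hull {a, b, e}"
    then obtain r s t where rst: "s \<ge> 0" "t \<ge> 0" "r + s + t = 1" "y = r *\<^sub>R a + s *\<^sub>R b + t *\<^sub>R e"
      unfolding convex_hull_3 by auto
    \<comment> \<open>The edge direction \<open>u\<close> is orthogonal to \<open>n0\<close>, so
      only the weight \<open>t\<close> of the corner \<open>e\<close> will matter.\<close>
    have "y - a = s *\<^sub>R u + t *\<^sub>R w"
    proof -
      have "r = 1 - s - t" using rst(3) by linarith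
      show ?thesis
        unfolding rst(4) u_def w_def \<open>r = 1 - s - t\<close> by (simp add: algebra_simps)
    qed
    then have "n0 \<bullet> (y - a) = - (t * \<bar>D\<bar> / norm u)"
      by (simp add: n0_def inner_add_right rot90_orthogonal inner_commute[of "rot90 u" u] abs_sgn
          flip: cross_eq_inner D_def)
    then show "n0 \<bullet> (y - a) \<le> 0" using rst(2) by simp
  next
    fix n :: "real^2"
    assume n: "norm n = 1 \<and> n \<bullet> (b - a) = 0 \<and> (\<forall>y\<in>convex hull {a, b, e}. n \<bullet> (y - a) \<le> 0)"
    then obtain k where k: "n = k *\<^sub>R rot90 u"
      using orthogonal_imp_multiple_rot90[of n u] u0 by (auto simp: u_def)
    \<comment> \<open>Testing the half-plane condition at \<open>e\<close> alone fixes the sign of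
      \<open>k\<close>; the norm fixes its size.\<close>
    have "e \<in> convex hull {a, b, e}" by (simp add: hull_inc)
    then have "k * D \<le> 0"
      using n k by (auto simp: D_def w_def cross_eq_inner)
    moreover have "\<bar>k\<bar> * norm u = 1" using n k by simp
    then have "\<bar>k\<bar> = 1 / norm u" using u0 by (simp add: field_simps)
    ultimately have "k = - (sgn D / norm u)"
      using D0 u0 by (auto simp: sgn_if abs_if mult_le_0_iff split: if_splits)
    then show "n = n0" by (simp add: k n0_def)
  qed
  then show ?thesis
    using u0 by (simp add: n0_def D_def w_def norm_minus_commute[of a b] flip: u_def)
qed

lemma measure_triangle:
  fixes a b e :: "real^2"
  shows "measure lebesgue (convex hull {a, b, e}) = \<bar>cross (b - a) (e - a)\<bar> / 2"
proof -
  have "compact (convex hull {a, b, e})"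
    by (intro compact_convex_hull finite_imp_compact) simp
  then have "measure lebesgue (convex hull {a, b, e}) = measure lborel (convex hull {a, b, e})"
    by (intro measure_completion) (simp add: borel_compact)
  also have "\<dots> = \<bar>cross (b - a) (e - a)\<bar> / 2"
    by (simp add: content_triangle cross_def abs_minus_commute algebra_simps)
  finally show ?thesis .
qed

section \<open>Corner vectors and the gradient at one vertex\<close>

text \<open>Exchanging \<open>d\<close> and \<open>e\<close> reverses the orientation, so the two
  turned edges at \<open>c\<close> enter with opposite signs and combine to the turned opposite
  edge.\<close>

lemma corner_normal_triangle:
  assumes "cells_at \<Omega> C x p = {c, d, e}" "distinct [c, d, e]"
    and "cross (x d - x c) (x e - x c) \<noteq> 0"
  shows "corner_normal \<Omega> C x c p
           = (sgn (cross (x d - x c) (x e - x c)) / 2) *\<^sub>R rot90 (x e - x d)"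
proof -
  have T: "dual_triangle \<Omega> C x p = convex hull {x c, x d, x e}"
          "dual_triangle \<Omega> C x p = convex hull {x c, x e, x d}"
    using assms(1) by (simp_all add: dual_triangle_def insert_commute)
  have swap: "cross (x e - x c) (x d - x c) = - cross (x d - x c) (x e - x c)"
    by (simp add: cross_def)
  have "cells_at \<Omega> C x p - {c} = {d, e}" using assms(1,2) by auto
  then have "corner_normal \<Omega> C x c p =
      (1/2) *\<^sub>R (norm (x c - x d) *\<^sub>R outward_normal (dual_triangle \<Omega> C x p) (x c) (x d)) +
      (1/2) *\<^sub>R (norm (x c - x e) *\<^sub>R outward_normal (dual_triangle \<Omega> C x p) (x c) (x e))"
    using assms(2) by (simp add: corner_normal_def)
  also have "norm (x c - x d) *\<^sub>R outward_normal (dual_triangle \<Omega> C x p) (x c) (x d)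
      = - (sgn (cross (x d - x c) (x e - x c)) *\<^sub>R rot90 (x d - x c))"
    unfolding T(1) by (rule outward_normal_triangle[OF assms(3)])
  also have "norm (x c - x e) *\<^sub>R outward_normal (dual_triangle \<Omega> C x p) (x c) (x e)
      = sgn (cross (x d - x c) (x e - x c)) *\<^sub>R rot90 (x e - x c)"
    unfolding T(2) using outward_normal_triangle[of "x e" "x c" "x d"] assms(3)
    by (simp add: swap sgn_minus)
  finally show ?thesis
    by (simp add: real2_eq_iff field_simps)
qed

lemma corner_tangent_eq_rot90: "corner_tangent \<Omega> C x c p = rot90 (corner_normal \<Omega> C x c p)"
  by (simp add: corner_tangent_def rot90_def inner_axis)

text \<open>The tangent at \<open>c\<close> is parallel to the opposite edge, hence orthogonal to
  the normal at \<open>c\<close>: the value \<open>\<phi> c\<close> drops out. The other two normals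
  give opposite multiples of the doubled area, which cancels against the area in the
  gradient.\<close>

lemma corner_tangent_inner_grad:
  assumes "cells_at \<Omega> C x p = {c, d, e}" "distinct [c, d, e]"
    and "cross (x d - x c) (x e - x c) \<noteq> 0"
  shows "corner_tangent \<Omega> C x c p \<bullet> discrete_grad \<Omega> C x \<phi> p
           = sgn (cross (x d - x c) (x e - x c)) / 2 * (\<phi> d - \<phi> e)"
proof -
  define D where "D = cross (x d - x c) (x e - x c)"
  \<comment> \<open>Cyclic permutation keeps the orientation, so the formula for one corner serves
    all three with the same \<open>D\<close>.\<close>
  have rotate: "cross (x e - x d) (x c - x d) = D" "cross (x c - x e) (x d - x e) = D"
    by (simp_all add: D_def cross_def algebra_simps)
  have D0: "D \<noteq> 0" using assms(3) by (simp add: D_def)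
  have nc: "corner_normal \<Omega> C x c p = (sgn D / 2) *\<^sub>R rot90 (x e - x d)"
    using corner_normal_triangle[OF assms] by (simp add: D_def)
  have nd: "corner_normal \<Omega> C x d p = (sgn D / 2) *\<^sub>R rot90 (x c - x e)"
    using corner_normal_triangle[of \<Omega> C x p d e c] assms(1,2) D0
    by (auto simp: rotate insert_commute)
  have ne: "corner_normal \<Omega> C x e p = (sgn D / 2) *\<^sub>R rot90 (x d - x c)"
    using corner_normal_triangle[of \<Omega> C x p e c d] assms(1,2) D0
    by (auto simp: rotate insert_commute)
  have area: "measure lebesgue (dual_triangle \<Omega> C x p) = \<bar>D\<bar> / 2"
    using assms(1) by (simp add: dual_triangle_def measure_triangle D_def)
  \<comment> \<open>The common factor \<open>sgn D / 2\<close> divided by the area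
    \<open>\<bar>D\<bar> / 2\<close> is \<open>1 / D\<close>.\<close>
  have g: "discrete_grad \<Omega> C x \<phi> p = (1 / D) *\<^sub>R
      (\<phi> c *\<^sub>R rot90 (x e - x d) + \<phi> d *\<^sub>R rot90 (x c - x e) + \<phi> e *\<^sub>R rot90 (x d - x c))"
    using assms(1,2) D0
    by (simp add: discrete_grad_def area nc nd ne real2_eq_iff sgn_if abs_if field_simps)
  have t: "corner_tangent \<Omega> C x c p = (sgn D / 2) *\<^sub>R (x d - x e)"
    by (simp add: corner_tangent_eq_rot90 nc real2_eq_iff algebra_simps)
  have "(x d - x e) \<bullet> (\<phi> c *\<^sub>R rot90 (x e - x d) + \<phi> d *\<^sub>R rot90 (x c - x e) + \<phi> e *\<^sub>R rot90 (x d - x c))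
      = D * (\<phi> d - \<phi> e)"
    by (simp add: D_def cross_def inner_real2 algebra_simps)
  then show ?thesis
    unfolding g t using D0 by (simp add: D_def)
qed

section \<open>Bisectors and the cells around a dual vertex\<close>

text \<open>With a point \<open>p\<close> of the bisector as origin the constant term disappears,
  and comparing distances amounts to the sign of a linear form.\<close>

lemma dist_compare_from_equidistant:
  fixes a b p y :: "'a::real_inner"
  assumes "dist p a = dist p b"
  shows "dist y a \<le> dist y b \<longleftrightarrow> (y - p) \<bullet> (b - a) \<le> 0"
    and "dist y a = dist y b \<longleftrightarrow> (y - p) \<bullet> (b - a) = 0"
proof -
  have p: "(p - a) \<bullet> (p - a) = (p - b) \<bullet> (p - b)"
    using assms by (simp add: dist_norm norm_eq)
  have eq: "(y - a) \<bullet> (y - a) - (y - b) \<bullet> (y - b) = 2 * ((y - p) \<bullet> (b - a))"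
    using p by (simp add: algebra_simps inner_commute)
  show "dist y a \<le> dist y b \<longleftrightarrow> (y - p) \<bullet> (b - a) \<le> 0"
    unfolding dist_norm norm_le using eq by auto
  show "dist y a = dist y b \<longleftrightarrow> (y - p) \<bullet> (b - a) = 0"
    unfolding dist_norm norm_eq using eq by auto
qed

lemma cells_at_equidistant:
  assumes "c \<in> cells_at \<Omega> C x p" "d \<in> cells_at \<Omega> C x p"
  shows "dist p (x c) = dist p (x d)"
  using assms by (auto simp: cells_at_def voronoi_cell_def intro: antisym)

lemma dual_vertex_triple:
  assumes "dual_vertex \<Omega> C x p" "c \<in> cells_at \<Omega> C x p" "d \<in> cells_at \<Omega> C x p" "d \<noteq> c"
  obtains e where "cells_at \<Omega> C x p = {c, d, e}" "distinct [c, d, e]"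
    "cross (x d - x c) (x e - x c) \<noteq> 0"
proof -
  have "card (cells_at \<Omega> C x p) = 3" using assms(1) by (simp add: dual_vertex_def)
  then have "card (cells_at \<Omega> C x p - {c, d}) = 1"
    using assms by (subst card_Diff_subset) auto
  then obtain e where e: "cells_at \<Omega> C x p - {c, d} = {e}" by (auto simp: card_1_singleton_iff)
  then have *: "cells_at \<Omega> C x p = {c, d, e}" "distinct [c, d, e]" using assms by auto
  moreover have "\<not> collinear {x c, x d, x e}"
    using assms(1) *(1) by (simp add: dual_vertex_def)
  ultimately show thesis using that cross_neq_0_if_not_collinear by blast
qed

text \<open>Walk from \<open>p\<close> along the bisector of \<open>c\<close> and \<open>d\<close>,
  away from \<open>e\<close>. Since the three cells fill a neighbourhood of \<open>p\<close>, a
  short step neither leaves \<open>closure \<Omega>\<close> nor comes nearer to a fourth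
  generator.\<close>

lemma edge_not_single_point:
  assumes dual: "dual_vertex \<Omega> C x p" and cells: "cells_at \<Omega> C x p = {c, d, e}"
    and D0: "cross (x d - x c) (x e - x c) \<noteq> 0"
  obtains y where "y \<in> voronoi_cell \<Omega> C x c" "dist y (x c) = dist y (x d)" "y \<noteq> p"
proof -
  define D where "D = cross (x d - x c) (x e - x c)"
  \<comment> \<open>The factor \<open>- D\<close> gives \<open>v\<close> the inner product
    \<open>- D * D\<close> with \<open>x e - x c\<close>, which is negative for either
    orientation.\<close>
  define v where "v = (- D) *\<^sub>R rot90 (x d - x c)"
  have v0: "v \<noteq> 0" using D0 by (auto simp: v_def D_def real2_eq_iff cross_def)
  let ?U = "\<Union>c\<in>cells_at \<Omega> C x p. voronoi_cell \<Omega> C x c"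
  have "p \<in> interior ?U" using dual by (simp add: dual_vertex_def)
  then obtain \<epsilon> where \<epsilon>: "\<epsilon> > 0" "ball p \<epsilon> \<subseteq> ?U" by (auto simp: mem_interior)
  define \<delta> where "\<delta> = \<epsilon> / (2 * norm v)"
  have \<delta>: "\<delta> > 0" using \<epsilon> v0 by (simp add: \<delta>_def)
  define y where "y = p + \<delta> *\<^sub>R v"
  have "y \<in> ball p \<epsilon>" using \<epsilon> v0 by (simp add: y_def dist_norm \<delta>_def)
  then obtain b where b: "b \<in> {c, d, e}" "y \<in> voronoi_cell \<Omega> C x b"
    using \<epsilon>(2) unfolding cells by blast
  have yd: "dist y (x c) = dist y (x d)"
    by (subst dist_compare_from_equidistant(2)[OF cells_at_equidistant[of c \<Omega> C x p d]])
       (simp_all add: cells y_def v_def inner_commute[of "rot90 _"] rot90_orthogonal)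
  have "(y - p) \<bullet> (x e - x c) = - (\<delta> * D * D)"
    by (simp add: y_def v_def D_def cross_eq_inner)
  then have ye: "dist y (x c) \<le> dist y (x e)"
    by (subst dist_compare_from_equidistant(1)[OF cells_at_equidistant[of c \<Omega> C x p e]])
       (use \<delta> in \<open>simp_all add: cells mult.assoc\<close>)
  \<comment> \<open>No generator is nearer to \<open>y\<close> than that of \<open>b\<close>, and
    that of \<open>c\<close> is at least as near.\<close>
  have "dist y (x c) \<le> dist y (x b)" using b(1) yd ye by auto
  then have "y \<in> voronoi_cell \<Omega> C x c"
    using b(2) by (force simp: voronoi_cell_def)
  moreover have "y \<noteq> p" using \<delta> v0 by (simp add: y_def)
  ultimately show thesis using that yd by blast
qed

section \<open>Orientations at the two ends of a shared edge\<close>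

lemma compact_voronoi_cell:
  assumes "voronoi_mesh \<Omega> C x"
  shows "compact (voronoi_cell \<Omega> C x c)"
proof -
  have "voronoi_cell \<Omega> C x c = closure \<Omega> \<inter> (\<Inter>d\<in>C. {y. dist y (x c) \<le> dist y (x d)})"
    by (auto simp: voronoi_cell_def)
  moreover have "closed (\<Inter>d\<in>C. {y. dist y (x c) \<le> dist y (x d)})"
    by (intro closed_INT ballI closed_Collect_le continuous_intros)
  moreover have "compact (closure \<Omega>)"
    using assms by (simp add: voronoi_mesh_def compact_closure)
  ultimately show ?thesis by (simp add: compact_Int_closed)
qed

text \<open>The two ends of the edge between the cells of \<open>c\<close> and \<open>d\<close> are the maximum and the minimum
  along the bisector of the part of it that lies in the cell of \<open>c\<close>. The cell itself need not be
  convex, since \<open>\<Omega>\<close> need not be.\<close>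

lemma sum_orientations_edge:
  assumes mesh: "voronoi_mesh \<Omega> C x" and cd: "c \<in> C" "d \<in> C" "d \<noteq> c"
    and dual: "\<And>p. p \<in> cell_vertices \<Omega> C x c \<Longrightarrow> dual_vertex \<Omega> C x p"
  shows "(\<Sum>p | p \<in> cell_vertices \<Omega> C x c \<and> d \<in> cells_at \<Omega> C x p.
            sgn (\<Sum>e\<in>cells_at \<Omega> C x p. cross (x d - x c) (x e - x c))) = 0"
    (is "sum ?s ?A = 0")
proof (cases "?A = {}")
  case True
  then show ?thesis by (simp only: sum.empty)
next
  case False
  define S where "S = voronoi_cell \<Omega> C x c"
  define u where "u = x d - x c"
  define F where "F = {y \<in> S. dist y (x c) = dist y (x d)}"
  have u0: "u \<noteq> 0" using mesh cd by (auto simp: u_def voronoi_mesh_def inj_on_def)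
  have A_F: "p \<in> F" if "p \<in> ?A" for p
    using that cd unfolding F_def S_def cell_vertices_def extreme_point_of_def cells_at_def voronoi_cell_def
    by (auto intro: antisym)
  have c_at: "c \<in> cells_at \<Omega> C x p" if "p \<in> S" for p
    using that cd by (simp add: cells_at_def S_def)
  have d_at: "d \<in> cells_at \<Omega> C x p" if "p \<in> F" for p
    using that cd by (auto simp: cells_at_def F_def S_def voronoi_cell_def)
  \<comment> \<open>\<open>F\<close> lies on the bisector, where \<open>cross u\<close> is a
    coordinate that determines the point.\<close>
  have F_line: "q - p = ((cross u q - cross u p) / (u \<bullet> u)) *\<^sub>R rot90 u" if "p \<in> F" "q \<in> F" for p q
  proof -
    have "(q - p) \<bullet> u = 0"
      using dist_compare_from_equidistant(2)[of p "x c" "x d" q] that by (simp add: F_def u_def)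
    from orthogonal_imp_multiple_rot90[OF this u0] show ?thesis
      by (simp add: cross_eq_inner inner_diff_right)
  qed
  have F_inj: "p = q" if "p \<in> F" "q \<in> F" "cross u p = cross u q" for p q
    using F_line[OF that(1,2)] that(3) by simp
  have "F = S \<inter> {y. dist y (x c) = dist y (x d)}" by (auto simp: F_def)
  moreover have "closed {y. dist y (x c) = dist y (x d)}"
    by (intro closed_Collect_eq continuous_intros)
  ultimately have compF: "compact F"
    using compact_voronoi_cell[OF mesh] by (simp add: S_def compact_Int_closed)
  have F_ne: "F \<noteq> {}" using False A_F by blast
  have cont: "continuous_on F (cross u)"
    unfolding cross_eq_inner[abs_def] by (intro continuous_intros)
  obtain p1 where p1: "p1 \<in> F" "\<And>y. y \<in> F \<Longrightarrow> cross u y \<le> cross u p1"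
    using continuous_attains_sup[OF compF F_ne cont] by blast
  obtain p2 where p2: "p2 \<in> F" "\<And>y. y \<in> F \<Longrightarrow> cross u p2 \<le> cross u y"
    using continuous_attains_inf[OF compF F_ne cont] by blast
  have cross_seg: "cross u ((1 - k) *\<^sub>R a + k *\<^sub>R b) = (1 - k) * cross u a + k * cross u b" for k a b
    by (simp add: cross_eq_inner inner_add_right)
  \<comment> \<open>\<open>S\<close> lies in the half-plane of points at least as near to
    \<open>c\<close> as to \<open>d\<close>, and \<open>F\<close> is its part on the boundary line.
    So \<open>F\<close> behaves like a face of \<open>S\<close>, without convexity of
    \<open>S\<close>.\<close>
  have F_face: "a \<in> F \<and> b \<in> F" if p: "p \<in> F" and ab: "a \<in> S" "b \<in> S" "p \<in> open_segment a b" for p a b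
  proof -
    obtain k where k: "0 < k" "k < 1" "p = (1 - k) *\<^sub>R a + k *\<^sub>R b"
      using ab(3) by (auto simp: in_segment)
    have le: "(y - p) \<bullet> u \<le> 0" if "y \<in> S" for y
      using that p cd dist_compare_from_equidistant(1)[of p "x c" "x d" y]
      by (auto simp: F_def S_def voronoi_cell_def u_def)
    have "(1 - k) * ((a - p) \<bullet> u) + k * ((b - p) \<bullet> u) = ((1 - k) *\<^sub>R a + k *\<^sub>R b - p) \<bullet> u"
      by (simp add: algebra_simps)
    also have "\<dots> = 0" using k(3) by simp
    finally have "(1 - k) * ((a - p) \<bullet> u) + k * ((b - p) \<bullet> u) = 0" .
    moreover have "(1 - k) * ((a - p) \<bullet> u) \<le> 0" "k * ((b - p) \<bullet> u) \<le> 0"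
      using k le ab by (simp_all add: mult_le_0_iff)
    ultimately have "(1 - k) * ((a - p) \<bullet> u) = 0" "k * ((b - p) \<bullet> u) = 0" by linarith+
    then have "(a - p) \<bullet> u = 0" "(b - p) \<bullet> u = 0" using k by auto
    then show ?thesis
      using ab p dist_compare_from_equidistant(2)[of p "x c" "x d"] by (simp add: F_def u_def)
  qed
  \<comment> \<open>By the face property a segment through \<open>p\<close> has both ends in
    \<open>F\<close>. At an extremum of \<open>cross u\<close> their deviations from
    \<open>p\<close> have the same sign but a vanishing weighted sum, so the ends coincide.\<close>
  have vertexI: "p \<in> ?A" if p: "p \<in> F"
    and ext: "(\<forall>y\<in>F. cross u y \<le> cross u p) \<or> (\<forall>y\<in>F. cross u p \<le> cross u y)" for p
  proof -
    have "p \<notin> open_segment a b" if ab: "a \<in> S" "b \<in> S" for a b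
    proof
      assume seg: "p \<in> open_segment a b"
      then obtain k where k: "0 < k" "k < 1" "p = (1 - k) *\<^sub>R a + k *\<^sub>R b" and "a \<noteq> b"
        by (auto simp: in_segment)
      have F: "a \<in> F" "b \<in> F" using F_face[OF p ab seg] by auto
      have "(1 - k) * (cross u a - cross u p) + k * (cross u b - cross u p) = 0"
        using cross_seg[of k a b] unfolding k(3)[symmetric] by (simp add: algebra_simps)
      moreover have "(1 - k) * (cross u a - cross u p) \<le> 0 \<and> k * (cross u b - cross u p) \<le> 0 \<or>
          0 \<le> (1 - k) * (cross u a - cross u p) \<and> 0 \<le> k * (cross u b - cross u p)"
        using ext F k by (auto simp: mult_le_0_iff zero_le_mult_iff)
      ultimately have "(1 - k) * (cross u a - cross u p) = 0" "k * (cross u b - cross u p) = 0"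
        by linarith+
      then have "cross u a = cross u b" using k by auto
      then show False using F_inj F \<open>a \<noteq> b\<close> by blast
    qed
    then show ?thesis
      using p d_at by (auto simp: cell_vertices_def extreme_point_of_def S_def F_def)
  qed
  have A: "?A = {p1, p2}"
  proof (intro equalityI subsetI)
    fix p assume "p \<in> {p1, p2}"
    then show "p \<in> ?A" using vertexI p1 p2 by blast
  next
    fix p assume p: "p \<in> ?A"
    show "p \<in> {p1, p2}"
    proof (rule ccontr)
      assume "p \<notin> {p1, p2}"
      then have strict: "cross u p2 < cross u p" "cross u p < cross u p1"
        using p1 p2 A_F[OF p] F_inj by (metis insertCI order_le_less)+
      \<comment> \<open>The relative position of \<open>p\<close> on the way from \<open>p2\<close>
        to \<open>p1\<close>, measured by \<open>cross u\<close>; a point strictly between two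
        points of \<open>S\<close> is not extreme.\<close>
      define k where "k = (cross u p - cross u p2) / (cross u p1 - cross u p2)"
      have k: "0 < k" "k < 1" using strict by (auto simp: k_def field_simps)
      have "p - p2 = ((cross u p - cross u p2) / (u \<bullet> u)) *\<^sub>R rot90 u"
        using F_line p2(1) A_F[OF p] by blast
      also have "\<dots> = k *\<^sub>R ((cross u p1 - cross u p2) / (u \<bullet> u)) *\<^sub>R rot90 u"
        using strict by (simp add: k_def)
      also have "\<dots> = k *\<^sub>R (p1 - p2)" using F_line p1(1) p2(1) by simp
      finally have "p = (1 - k) *\<^sub>R p2 + k *\<^sub>R p1" by (simp add: algebra_simps)
      then have "p \<in> open_segment p2 p1" using k strict by (auto simp: in_segment)
      then show False
        using p p1(1) p2(1) by (auto simp: cell_vertices_def extreme_point_of_def S_def F_def)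
    qed
  qed
  have triple: "\<exists>e. cells_at \<Omega> C x p = {c, d, e} \<and> distinct [c, d, e] \<and> cross u (x e - x c) \<noteq> 0"
    if "p \<in> ?A" for p
  proof -
    have "dual_vertex \<Omega> C x p" "c \<in> cells_at \<Omega> C x p" "d \<in> cells_at \<Omega> C x p"
      using that dual c_at[of p] A_F[OF that] by (auto simp: F_def)
    from dual_vertex_triple[OF this cd(3)] show ?thesis
      unfolding u_def by blast
  qed
  \<comment> \<open>The terms of \<open>c\<close> and \<open>d\<close> vanish, so the sum over all
    cells at \<open>p\<close> yields the orientation without naming the third cell.\<close>
  have s: "?s p = sgn (cross u (x e - x c))" if "cells_at \<Omega> C x p = {c, d, e}" "distinct [c, d, e]" for p e
    using that by (simp add: u_def)
  \<comment> \<open>Equal maximum and minimum would make \<open>F\<close> a single point,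
    contradicting the walk along the bisector.\<close>
  have "p1 \<noteq> p2"
  proof
    assume eq: "p1 = p2"
    obtain e where "cells_at \<Omega> C x p1 = {c, d, e}" "cross u (x e - x c) \<noteq> 0"
      using triple A by blast
    moreover have "dual_vertex \<Omega> C x p1" using dual A by blast
    ultimately obtain y where "y \<in> F" "y \<noteq> p1"
      using edge_not_single_point[of \<Omega> C x p1 c d e] unfolding F_def S_def u_def by blast
    then show False using p1 p2 eq F_inj by (metis antisym)
  qed
  then have lt: "cross u p2 < cross u p1"
    using p1 p2 F_inj by (metis order_le_less)
  \<comment> \<open>Going from \<open>p\<close> to \<open>q\<close> along the bisector must not
    bring the point nearer to \<open>e\<close> than to \<open>c\<close>, so displacement and
    orientation cannot have the same sign.\<close>
  have side: "(cross u q - cross u p) * cross u (x e - x c) \<le> 0"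
    if "p \<in> F" "q \<in> F" "e \<in> cells_at \<Omega> C x p" for p q e
  proof -
    have "dist p (x c) = dist p (x e)"
      using that c_at by (intro cells_at_equidistant) (auto simp: F_def)
    moreover have "dist q (x c) \<le> dist q (x e)"
      using that by (auto simp: F_def S_def voronoi_cell_def cells_at_def)
    ultimately have "(q - p) \<bullet> (x e - x c) \<le> 0" by (simp add: dist_compare_from_equidistant(1)[of p])
    moreover have "\<not> u \<bullet> u \<le> 0" using u0 by (simp add: not_le)
    ultimately show ?thesis
      unfolding F_line[OF that(1,2)] by (auto simp: divide_le_0_iff simp flip: cross_eq_inner)
  qed
  obtain e1 where e1: "cells_at \<Omega> C x p1 = {c, d, e1}" "distinct [c, d, e1]" "cross u (x e1 - x c) \<noteq> 0"
    using triple A by blast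
  obtain e2 where e2: "cells_at \<Omega> C x p2 = {c, d, e2}" "distinct [c, d, e2]" "cross u (x e2 - x c) \<noteq> 0"
    using triple A by blast
  \<comment> \<open>From the maximum the edge runs towards smaller \<open>cross u\<close>, from the
    minimum towards larger, which forces opposite orientations.\<close>
  have "?s p1 = 1"
    unfolding s[OF e1(1,2)] using side[of p1 p2 e1] p1(1) p2(1) e1 lt
    by (auto simp: mult_le_0_iff sgn_if)
  moreover have "?s p2 = -1"
    unfolding s[OF e2(1,2)] using side[of p2 p1 e2] p1(1) p2(1) e2 lt
    by (auto simp: mult_le_0_iff sgn_if)
  ultimately show ?thesis
    unfolding A using \<open>p1 \<noteq> p2\<close> by simp
qed

section \<open>Summation over the vertices of the cell\<close>

theorem mainTheorem1:
  fixes \<Omega> :: "(real^2) set" and C :: "'c set" and x :: "'c \<Rightarrow> real^2"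
    and \<phi> :: "'c \<Rightarrow> real" and c :: 'c
  assumes "voronoi_mesh \<Omega> C x"
    and "c \<in> C"
    and "\<And>p. p \<in> cell_vertices \<Omega> C x c \<Longrightarrow> dual_vertex \<Omega> C x p"
  shows "discrete_curl \<Omega> C x (discrete_grad \<Omega> C x \<phi>) c = 0"
proof (cases "finite (cell_vertices \<Omega> C x c)")
  case False
  \<comment> \<open>a sum over an infinite set is \<open>0\<close>\<close>
  then show ?thesis by (simp add: discrete_curl_def)
next
  case True
  define s where "s p d = sgn (\<Sum>e\<in>cells_at \<Omega> C x p. cross (x d - x c) (x e - x c))" for p d
  have finC: "finite C" using assms(1) by (simp add: voronoi_mesh_def)
  \<comment> \<open>Each of the two neighbours at \<open>p\<close> carries its own orientation sign,
    and these are opposite; thus the difference of values becomes a symmetric sum that needs no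
    ordering of the neighbours.\<close>
  have local_sum: "corner_tangent \<Omega> C x c p \<bullet> discrete_grad \<Omega> C x \<phi> p
      = (\<Sum>d | d \<in> C - {c} \<and> d \<in> cells_at \<Omega> C x p. s p d / 2 * \<phi> d)"
    if p: "p \<in> cell_vertices \<Omega> C x c" for p
  proof -
    have c: "c \<in> cells_at \<Omega> C x p"
      using p assms(2) by (simp add: cells_at_def cell_vertices_def extreme_point_of_def)
    have dual: "dual_vertex \<Omega> C x p" using assms(3) p by blast
    then have "card (cells_at \<Omega> C x p) = 3" by (simp add: dual_vertex_def)
    then have "cells_at \<Omega> C x p \<noteq> {c}" by auto
    then obtain d where "d \<in> cells_at \<Omega> C x p" "d \<noteq> c" using c by blast
    then obtain e where e: "cells_at \<Omega> C x p = {c, d, e}" "distinct [c, d, e]"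
        "cross (x d - x c) (x e - x c) \<noteq> 0"
      using dual_vertex_triple[OF dual c] by metis
    have "cross (x e - x c) (x d - x c) = - cross (x d - x c) (x e - x c)"
      by (simp add: cross_def)
    then have "s p d = sgn (cross (x d - x c) (x e - x c))"
        "s p e = - sgn (cross (x d - x c) (x e - x c))"
      using e(2) by (simp_all add: s_def e(1) sgn_minus)
    moreover have "{b. b \<in> C - {c} \<and> b \<in> cells_at \<Omega> C x p} = {d, e}"
      using e by (auto simp: cells_at_def)
    ultimately show ?thesis
      using corner_tangent_inner_grad[OF e] e(2) by (simp add: algebra_simps)
  qed
  have "(\<Sum>p\<in>cell_vertices \<Omega> C x c. corner_tangent \<Omega> C x c p \<bullet> discrete_grad \<Omega> C x \<phi> p)
      = (\<Sum>p\<in>cell_vertices \<Omega> C x c. \<Sum>d | d \<in> C - {c} \<and> d \<in> cells_at \<Omega> C x p. s p d / 2 * \<phi> d)"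
    by (intro sum.cong refl local_sum)
  also have "\<dots> = (\<Sum>d\<in>C - {c}. \<Sum>p | p \<in> cell_vertices \<Omega> C x c \<and> d \<in> cells_at \<Omega> C x p. s p d / 2 * \<phi> d)"
    using True finC by (intro sum.swap_restrict) auto
  also have "\<dots> = (\<Sum>d\<in>C - {c}.
      (\<Sum>p | p \<in> cell_vertices \<Omega> C x c \<and> d \<in> cells_at \<Omega> C x p. s p d) * (\<phi> d / 2))"
    by (simp add: sum_distrib_right sum_divide_distrib)
  \<comment> \<open>For each neighbour the signs at the two ends of the shared edge cancel; a cell
    sharing no vertex with \<open>c\<close> contributes an empty sum.\<close>
  also have "\<dots> = 0"
    unfolding s_def using assms by (intro sum.neutral) (auto simp: sum_orientations_edge)
  finally show ?thesis by (simp add: discrete_curl_def)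
qed

end
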